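(* Let $d_1,d_2$ be positive integers, let $V = \{1,\ldots,d_1+1\} \times \{1,\ldots,d_2+1\}$, and let $\mathcal{T} = (T^i)_{i=1}^d$ be a grid triangulation of $V$. Then there exists an independent branching formulation for $\bigcup_{i=1}^d P(T^i)$ of depth $\lceil \log_2(d_1) \rceil + \lceil \log_2(d_2) \rceil + 6$.
   Context: A grid triangulation of $V = \{1,\ldots,d_1+1\}\times\{1,\ldots,d_2+1\}$ is a family $\mathcal{T}$ of subsets of $V$ such that: (i) $|T| = 3$ for each $T \in \mathcal{T}$; (ii) $\bigcup_{T \in \mathcal{T}} \operatorname{Conv}(T) = \operatorname{Conv}(V)$, and $\operatorname{relint}(\operatorname{Conv}(T)) \cap \operatorname{relint}(\operatorname{Conv}(T')) = \emptyset$ for distinct $T,T' \in \mathcal{T}$; (iii) $\|v-w\|_\infty \le 1$ for each $T \in \mathcal{T}$ and $v,w \in T$. $\Delta^V = \{\lambda \in \mathbb{R}^V : \lambda \ge 0, \sum_{v \in V}\lambda_v = 1\}$, and for $T \subseteq V$, $P(T) = \{\lambda \in \Delta^V : \lambda_v = 0 \text{ for all } v \notin T\}$. An independent branching formulation of depth $r$ (i.e. with $r$ levels) for $\bigcup_{i=1}^d P(T^i)$ is given by pairs of sets $A^k, B^k \subseteq V$, $k = 1,\ldots,r$, such that $\lambda \in \bigcup_{i=1}^d P(T^i)$ if and only if there is $y$ such that $$\sum_{v \in A^k} \lambda_v \leq y_k, \qquad \sum_{v \in B^k} \lambda_v \leq 1 - y_k \quad \forall k \in \{1,\ldots,r\},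 \qquad (\lambda,y) \in \Delta^V \times \{0,1\}^r.$$ *)

theory Defs
  imports "HOL-Analysis.Analysis"
begin

text \<open>The grid points are points of the plane, so that convex hulls, relative interiors and the
  maximum norm (which is \<^const>\<open>infnorm\<close>) are those of the library.\<close>

definition grid :: "nat \<Rightarrow> nat \<Rightarrow> (real \<times> real) set" where
  "grid d1 d2 = (\<lambda>(i, j). (real i, real j)) ` ({1..d1 + 1} \<times> {1..d2 + 1})"

definition grid_triangulation :: "nat \<Rightarrow> nat \<Rightarrow> (real \<times> real) set set \<Rightarrow> bool" where
  "grid_triangulation d1 d2 \<T> \<longleftrightarrow>
     (\<forall>T\<in>\<T>. T \<subseteq> grid d1 d2 \<and> card T = 3) \<and>
     (\<Union>T\<in>\<T>. convex hull T) = convex hull (grid d1 d2) \<and>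
     (\<forall>T\<in>\<T>. \<forall>T'\<in>\<T>. T \<noteq> T' \<longrightarrow>
        rel_interior (convex hull T) \<inter> rel_interior (convex hull T') = {}) \<and>
     (\<forall>T\<in>\<T>. \<forall>v\<in>T. \<forall>w\<in>T. infnorm (v - w) \<le> 1)"

text \<open>The space \<open>\<real>\<^sup>V\<close> is represented by the extensional functions on \<open>V\<close>.\<close>

definition std_simplex :: "'v set \<Rightarrow> ('v \<Rightarrow> real) set" where
  "std_simplex V = {x \<in> V \<rightarrow>\<^sub>E UNIV. (\<forall>v\<in>V. 0 \<le> x v) \<and> (\<Sum>v\<in>V. x v) = 1}"

definition simplex_face :: "'v set \<Rightarrow> 'v set \<Rightarrow> ('v \<Rightarrow> real) set" where
  "simplex_face V T = {x \<in> std_simplex V. \<forall>v\<in>V - T. x v = 0}"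

definition independent_branching_formulation ::
  "'v set \<Rightarrow> ('v \<Rightarrow> real) set \<Rightarrow> nat \<Rightarrow> (nat \<Rightarrow> 'v set) \<Rightarrow> (nat \<Rightarrow> 'v set) \<Rightarrow> bool" where
  "independent_branching_formulation V S r A B \<longleftrightarrow>
     (\<forall>k\<in>{1..r}. A k \<subseteq> V \<and> B k \<subseteq> V) \<and>
     (\<forall>x. x \<in> S \<longleftrightarrow>
        (\<exists>y. (\<forall>k\<in>{1..r}. (\<Sum>v\<in>A k. x v) \<le> y k \<and> (\<Sum>v\<in>B k. x v) \<le> 1 - y k) \<and>
             x \<in> std_simplex V \<and> y \<in> {1..r} \<rightarrow>\<^sub>E {0, 1}))"

end

theory Submission
  imports Defs
begin

text \<open>
  Whether a point of the simplex lies in the union of faces depends only on its support, a nonempty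
  set of grid points. One level of a branching formulation says that the support misses \<open>A k\<close> or
  misses \<open>B k\<close>, that is, it forbids all pairs in \<open>A k \<times> B k\<close>. A formulation of depth \<open>r\<close> therefore
  amounts to \<open>r\<close> bicliques that contain no pair lying in a common triangle, and whose forbidden
  pairs suffice to force a support into a triangle
  (\<open>branching_formulation_of_biclique_cover\<close>).

  Each triangle consists of three corners of a unit square, and each unit square is the
  union of the two triangles on one of its diagonals (\<open>unit_square_triangulated\<close>). Hence it is enough
  to forbid the pairs whose first coordinates differ by at least 2, the pairs whose second coordinates
  do, and the missing diagonals: a set without such a pair lies in a unit square and omits an end of
  its missing diagonal, so it lies in one of the two triangles.

  Pairs at distance at least 2 on a path with at most \<open>2 ^ r\<close> edges need only \<open>r\<close> bicliques: one
  separates the two sides of the midpoint, and folding the path there reduces the remaining pairs to a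
  path of half the length (\<open>biclique_cover_path\<close>). The missing diagonals of one direction need three
  (\<open>biclique_cover_diagonals\<close>). On a single line of that direction, the missing diagonals cut the line
  into pieces, and putting the pieces alternately into \<open>A\<close> and \<open>B\<close> separates the ends of every
  missing diagonal but not the ends of a diagonal that some triangle contains. All lines of one residue class modulo 3 can share a biclique,
  since points on different lines of a class never lie in a common triangle. Two directions give the
  summand 6.
\<close>

section \<open>Biclique covers and branching formulations\<close>

text \<open>The pairs in \<open>E\<close> must not be separated by any biclique, those in \<open>M\<close> must be separated by one,
  in either order.\<close>

definition biclique_cover :: "('v \<times> 'v) set \<Rightarrow> ('v \<times> 'v) set \<Rightarrow> nat \<Rightarrow> bool" where
  "biclique_cover E M r \<longleftrightarrow>
     (\<exists>A B. (\<forall>k\<in>{1..r}. A k \<times> B k \<inter> E = {}) \<and>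
            M \<subseteq> (\<Union>k\<in>{1..r}. A k \<times> B k \<union> B k \<times> A k))"

lemma biclique_cover_vimage:
  assumes "biclique_cover E M r"
    and "\<And>u v. (u, v) \<in> E' \<Longrightarrow> (f u, f v) \<in> E"
    and "\<And>u v. (u, v) \<in> M' \<Longrightarrow> (f u, f v) \<in> M"
  shows "biclique_cover E' M' r"
proof -
  obtain A B where AB: "\<forall>k\<in>{1..r}. A k \<times> B k \<inter> E = {}"
      "M \<subseteq> (\<Union>k\<in>{1..r}. A k \<times> B k \<union> B k \<times> A k)"
    using assms(1) unfolding biclique_cover_def by blast
  have "\<forall>k\<in>{1..r}. (f -` A k) \<times> (f -` B k) \<inter> E' = {}"
    using AB(1) assms(2) by blast
  moreover have "M' \<subseteq> (\<Union>k\<in>{1..r}. (f -` A k) \<times> (f -` B k) \<union> (f -` B k) \<times> (f -` A k))"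
    using AB(2) assms(3) by fastforce
  ultimately show ?thesis
    unfolding biclique_cover_def
    by (intro exI[of _ "\<lambda>k. f -` A k"] exI[of _ "\<lambda>k. f -` B k"] conjI)
qed

lemma biclique_cover_Un:
  assumes "biclique_cover E M r" and "biclique_cover E M' r'"
  shows "biclique_cover E (M \<union> M') (r + r')"
proof -
  obtain A B where AB: "\<forall>k\<in>{1..r}. A k \<times> B k \<inter> E = {}"
      "M \<subseteq> (\<Union>k\<in>{1..r}. A k \<times> B k \<union> B k \<times> A k)"
    using assms(1) unfolding biclique_cover_def by blast
  obtain A' B' where AB': "\<forall>k\<in>{1..r'}. A' k \<times> B' k \<inter> E = {}"
      "M' \<subseteq> (\<Union>k\<in>{1..r'}. A' k \<times> B' k \<union> B' k \<times> A' k)"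
    using assms(2) unfolding biclique_cover_def by blast
  define C where "C k = (if k \<le> r then A k else A' (k - r))" for k
  define D where "D k = (if k \<le> r then B k else B' (k - r))" for k
  have 1: "C k \<times> D k \<inter> E = {}" if "k \<in> {1..r + r'}" for k
  proof (cases "k \<le> r")
    case True
    then show ?thesis using that AB(1) by (simp add: C_def D_def)
  next
    case False
    then have "k - r \<in> {1..r'}" using that by auto
    then show ?thesis using False AB'(1) by (simp add: C_def D_def)
  qed
  have 2: "p \<in> (\<Union>k\<in>{1..r + r'}. C k \<times> D k \<union> D k \<times> C k)" if "p \<in> M \<union> M'" for p
    using that
  proof
    assume "p \<in> M"
    then obtain k where k: "k \<in> {1..r}" "p \<in> A k \<times> B k \<union> B k \<times> A k"
      using AB(2) by blast
    then have "k \<in> {1..r + r'}" "p \<in> C k \<times> D k \<union> D k \<times> C k"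
      by (auto simp: C_def D_def)
    then show ?thesis by blast
  next
    assume "p \<in> M'"
    then obtain k where k: "k \<in> {1..r'}" "p \<in> A' k \<times> B' k \<union> B' k \<times> A' k"
      using AB'(2) by blast
    then have "k + r \<in> {1..r + r'}" "p \<in> C (k + r) \<times> D (k + r) \<union> D (k + r) \<times> C (k + r)"
      by (auto simp: C_def D_def)
    then show ?thesis by blast
  qed
  show ?thesis
    unfolding biclique_cover_def using 1 2 by blast
qed

text \<open>In level \<open>k\<close>, the choice \<open>y k = 0\<close> says that the support of \<open>x\<close> misses \<open>A k\<close>, and \<open>y k = 1\<close> that it
  misses \<open>B k\<close>; the other inequality of the level then holds because the weights of \<open>x\<close> sum to 1.\<close>

lemma branching_formulation_of_biclique_cover:
  fixes V :: "'v set" and \<T> :: "'v set set"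
  assumes fin: "finite V"
    and cov: "biclique_cover {(u, v). \<exists>T\<in>\<T>. u \<in> T \<and> v \<in> T} M r"
    and clique: "\<And>S. S \<subseteq> V \<Longrightarrow> S \<noteq> {} \<Longrightarrow> S \<times> S \<inter> M = {} \<Longrightarrow> \<exists>T\<in>\<T>. S \<subseteq> T"
  shows "\<exists>A B. independent_branching_formulation V (\<Union>T\<in>\<T>. simplex_face V T) r A B"
proof -
  obtain A B where sep: "\<forall>k\<in>{1..r}. A k \<times> B k \<inter> {(u, v). \<exists>T\<in>\<T>. u \<in> T \<and> v \<in> T} = {}"
    and M: "M \<subseteq> (\<Union>k\<in>{1..r}. A k \<times> B k \<union> B k \<times> A k)"
    using cov unfolding biclique_cover_def by (elim exE conjE) (rule that)
  define supp where "supp x = {v\<in>V. x v \<noteq> 0}" for x :: "'v \<Rightarrow> real"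
  have sum0: "(\<Sum>v\<in>C \<inter> V. x v) \<le> 0 \<longleftrightarrow> supp x \<inter> C = {}"
    if "x \<in> std_simplex V" for x C
  proof -
    have nn: "\<forall>v\<in>C \<inter> V. 0 \<le> x v" using that by (auto simp: std_simplex_def)
    then have "0 \<le> (\<Sum>v\<in>C \<inter> V. x v)"
      by (intro sum_nonneg) blast
    then have "(\<Sum>v\<in>C \<inter> V. x v) \<le> 0 \<longleftrightarrow> (\<Sum>v\<in>C \<inter> V. x v) = 0"
      by linarith
    also have "\<dots> \<longleftrightarrow> (\<forall>v\<in>C \<inter> V. x v = 0)"
      using nn fin by (intro sum_nonneg_eq_0_iff) auto
    finally show ?thesis by (auto simp: supp_def)
  qed
  have sum1: "(\<Sum>v\<in>C \<inter> V. x v) \<le> 1" if "x \<in> std_simplex V" for x C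
  proof -
    have "(\<Sum>v\<in>C \<inter> V. x v) \<le> (\<Sum>v\<in>V. x v)"
      using that fin by (intro sum_mono2) (auto simp: std_simplex_def)
    then show ?thesis using that by (simp add: std_simplex_def)
  qed
  have face: "x \<in> simplex_face V T \<longleftrightarrow> x \<in> std_simplex V \<and> supp x \<subseteq> T" for x T
    by (auto simp: simplex_face_def supp_def)
  have main: "x \<in> (\<Union>T\<in>\<T>. simplex_face V T) \<longleftrightarrow>
        (\<exists>y. (\<forall>k\<in>{1..r}. (\<Sum>v\<in>A k \<inter> V. x v) \<le> y k \<and> (\<Sum>v\<in>B k \<inter> V. x v) \<le> 1 - y k) \<and>
             x \<in> std_simplex V \<and> y \<in> {1..r} \<rightarrow>\<^sub>E {0, 1})" for x
  proof
    assume "x \<in> (\<Union>T\<in>\<T>. simplex_face V T)"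
    then obtain T where T: "T \<in> \<T>" "x \<in> std_simplex V" "supp x \<subseteq> T" by (auto simp: face)
    define y :: "nat \<Rightarrow> real" where
      "y = (\<lambda>k\<in>{1..r}. if supp x \<inter> A k = {} then 0 else 1)"
    have "(\<Sum>v\<in>A k \<inter> V. x v) \<le> y k \<and> (\<Sum>v\<in>B k \<inter> V. x v) \<le> 1 - y k" if k: "k \<in> {1..r}" for k
    proof (cases "supp x \<inter> A k = {}")
      case True
      then show ?thesis using k sum0[OF T(2)] sum1[OF T(2)] by (simp add: y_def)
    next
      case False
      then have "supp x \<inter> B k = {}" using sep k T by blast
      then show ?thesis using False k sum0[OF T(2)] sum1[OF T(2)] by (simp add: y_def)
    qed
    moreover have "y \<in> {1..r} \<rightarrow>\<^sub>E {0, 1}" by (auto simp: y_def)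
    ultimately show "\<exists>y. (\<forall>k\<in>{1..r}. (\<Sum>v\<in>A k \<inter> V. x v) \<le> y k \<and> (\<Sum>v\<in>B k \<inter> V. x v) \<le> 1 - y k) \<and>
             x \<in> std_simplex V \<and> y \<in> {1..r} \<rightarrow>\<^sub>E {0, 1}"
      using T(2) by blast
  next
    assume "\<exists>y. (\<forall>k\<in>{1..r}. (\<Sum>v\<in>A k \<inter> V. x v) \<le> y k \<and> (\<Sum>v\<in>B k \<inter> V. x v) \<le> 1 - y k) \<and>
             x \<in> std_simplex V \<and> y \<in> {1..r} \<rightarrow>\<^sub>E {0, 1}"
    then obtain y where y: "\<And>k. k \<in> {1..r} \<Longrightarrow> (\<Sum>v\<in>A k \<inter> V. x v) \<le> y k"
        "\<And>k. k \<in> {1..r} \<Longrightarrow> (\<Sum>v\<in>B k \<inter> V. x v) \<le> 1 - y k" "y \<in> {1..r} \<rightarrow>\<^sub>E {0, 1}"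
      and x: "x \<in> std_simplex V" by blast
    have dis: "supp x \<inter> A k = {} \<or> supp x \<inter> B k = {}" if k: "k \<in> {1..r}" for k
    proof -
      have "y k = 0 \<or> y k = 1" using y(3) k by blast
      then show ?thesis using y(1,2)[OF k] sum0[OF x] by fastforce
    qed
    have "supp x \<times> supp x \<inter> M = {}" using M dis by fastforce
    moreover have "supp x \<noteq> {}"
    proof
      assume "supp x = {}"
      then have "(\<Sum>v\<in>V. x v) = 0" by (auto simp: supp_def intro!: sum.neutral)
      then show False using x by (simp add: std_simplex_def)
    qed
    ultimately obtain T where "T \<in> \<T>" "supp x \<subseteq> T"
      using clique[of "supp x"] by (auto simp: supp_def)
    then show "x \<in> (\<Union>T\<in>\<T>. simplex_face V T)" using x by (auto simp: face)
  qed
  show ?thesis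
    unfolding independent_branching_formulation_def
    using main by (intro exI[of _ "\<lambda>k. A k \<inter> V"] exI[of _ "\<lambda>k. B k \<inter> V"]) auto
qed

section \<open>Pairs at distance at least 2 on a path\<close>

text \<open>Folding at the midpoint \<open>m\<close> does not increase distances, so bicliques of the half path stay
  admissible when pulled back. It preserves the distance of points on the same side of \<open>m\<close>, so only pairs
  on opposite sides may be lost, and these are exactly what the additional biclique separates; it is
  admissible because such points are at distance at least 2.\<close>

lemma biclique_cover_path:
  "biclique_cover {(u, v :: int). \<bar>u - v\<bar> \<le> 1}
     {(u, v). u \<in> {0..2 ^ r} \<and> v \<in> {0..2 ^ r} \<and> \<bar>u - v\<bar> \<ge> 2} r"
proof (induction r)
  case 0
  have "{(u, v :: int). u \<in> {0..2 ^ 0} \<and> v \<in> {0..2 ^ 0} \<and> \<bar>u - v\<bar> \<ge> 2} = {}"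
    by auto
  then show ?case by (simp only: biclique_cover_def) simp
next
  case (Suc r)
  define m :: int where "m = 2 ^ r"
  let ?E = "{(u, v :: int). \<bar>u - v\<bar> \<le> 1}"
  have fold: "biclique_cover ?E {(u, v). \<bar>u - m\<bar> \<in> {0..2 ^ r} \<and> \<bar>v - m\<bar> \<in> {0..2 ^ r} \<and>
      \<bar>\<bar>u - m\<bar> - \<bar>v - m\<bar>\<bar> \<ge> 2} r"
    by (rule biclique_cover_vimage[OF Suc.IH, where f = "\<lambda>u. \<bar>u - m\<bar>"]) auto
  have split: "biclique_cover ?E ({..<m} \<times> {m<..} \<union> {m<..} \<times> {..<m}) 1"
    unfolding biclique_cover_def
    by (intro exI[of _ "\<lambda>_. {..<m}"] exI[of _ "\<lambda>_. {m<..}"]) auto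
  show ?case
    by (rule biclique_cover_vimage[OF biclique_cover_Un[OF fold split, simplified], where f = "\<lambda>u. u"])
      (auto simp: m_def)
qed

section \<open>Missing diagonals\<close>

text \<open>The witness is the parity of the number of positions in \<open>{0..<i}\<close> at which \<open>b\<close> holds. It is constant
  on the negative integers, where \<open>b\<close> is not counted, hence the condition \<open>0 \<le> i\<close> in one direction.\<close>

lemma ex_parity_split:
  fixes b :: "int \<Rightarrow> bool"
  shows "\<exists>p :: int \<Rightarrow> bool. \<forall>i. (p i \<noteq> p (i + 1) \<longrightarrow> b i) \<and> (0 \<le> i \<and> b i \<longrightarrow> p i \<noteq> p (i + 1))"
proof -
  define p where "p i = even (card {j\<in>{0..<i}. b j})" for i
  have "p (i + 1) \<longleftrightarrow> (p i \<noteq> b i)" if "0 \<le> i" for i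
  proof -
    have "{j\<in>{0..<i + 1}. b j} = (if b i then insert i else id) {j\<in>{0..<i}. b j}"
      using that by (auto simp: order_less_le)
    moreover have "finite {j\<in>{0..<i}. b j}" "i \<notin> {j\<in>{0..<i}. b j}"
      by (auto intro: finite_subset[of _ "{0..<i}"])
    ultimately show ?thesis by (simp add: p_def del: mem_Collect_eq)
  qed
  moreover have "p (i + 1) = p i" if "i < 0" for i
    using that by (auto simp: p_def)
  ultimately show ?thesis by (intro exI[of _ p]) (metis linorder_not_le)
qed

text \<open>The lines of direction \<open>(1, s)\<close> are the level sets of \<open>j - s * i\<close>. Pairs in \<open>E\<close> change this value by at
  most 2, so a pair in \<open>E\<close> whose line values agree modulo 3 lies on a single line.\<close>

lemma biclique_cover_diagonals:
  fixes E :: "((int \<times> int) \<times> (int \<times> int)) set" and s :: int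
  assumes s: "\<bar>s\<bar> = 1"
    and symE: "sym E"
    and near: "\<And>p q. (p, q) \<in> E \<Longrightarrow> \<bar>fst p - fst q\<bar> \<le> 1 \<and> \<bar>snd p - snd q\<bar> \<le> 1"
  shows "biclique_cover E {((i, j), (i', j')). 0 \<le> i \<and> i' = i + 1 \<and> j' = j + s \<and> ((i, j), (i', j')) \<notin> E} 3"
proof -
  have "\<forall>c. \<exists>p :: int \<Rightarrow> bool. \<forall>i.
      (p i \<noteq> p (i + 1) \<longrightarrow> ((i, c + s * i), (i + 1, c + s * (i + 1))) \<notin> E) \<and>
      (0 \<le> i \<and> ((i, c + s * i), (i + 1, c + s * (i + 1))) \<notin> E \<longrightarrow> p i \<noteq> p (i + 1))"
    by (intro allI ex_parity_split)
  from choice[OF this] obtain p :: "int \<Rightarrow> int \<Rightarrow> bool" where p: "\<forall>c i.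
      (p c i \<noteq> p c (i + 1) \<longrightarrow> ((i, c + s * i), (i + 1, c + s * (i + 1))) \<notin> E) \<and>
      (0 \<le> i \<and> ((i, c + s * i), (i + 1, c + s * (i + 1))) \<notin> E \<longrightarrow> p c i \<noteq> p c (i + 1))"
    by (elim exE) (rule that)
  then have p1: "((i, c + s * i), (i + 1, c + s * (i + 1))) \<notin> E" if "p c i \<noteq> p c (i + 1)" for c i
    using that by blast
  have p2: "p c i \<noteq> p c (i + 1)"
    if "0 \<le> i" "((i, c + s * i), (i + 1, c + s * (i + 1))) \<notin> E" for c i
    using p that by blast
  \<comment> \<open>The level \<open>k\<close> ranges over \<open>1, 2, 3\<close>, and level 3 stands for residue class 0.\<close>
  define C where "C q k = {(i, j). (j - s * i) mod 3 = int k mod 3 \<and> p (j - s * i) i = q}"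
    for q and k :: nat
  have "C True k \<times> C False k \<inter> E = {}" for k
  proof (rule ccontr)
    assume "C True k \<times> C False k \<inter> E \<noteq> {}"
    then obtain i j i' j' where uv: "((i, j), (i', j')) \<in> E" "(i, j) \<in> C True k"
      "(i', j') \<in> C False k"
      by auto
    then have ij: "((i, j), (i', j')) \<in> E"
      "(j - s * i) mod 3 = (j' - s * i') mod 3" "p (j - s * i) i" "\<not> p (j' - s * i') i'"
      by (auto simp: C_def)
    have nr: "\<bar>i - i'\<bar> \<le> 1 \<and> \<bar>j - j'\<bar> \<le> 1" using near[OF ij(1)] by simp
    have s': "s = 1 \<or> s = - 1" using s by linarith
    have "\<bar>(j - s * i) - (j' - s * i')\<bar> \<le> 2" using nr s' by auto
    then have line: "j - s * i = j' - s * i'" using ij(2) by presburger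
    define c where "c = j - s * i"
    have jj: "j = c + s * i" "j' = c + s * i'" using line by (auto simp: c_def)
    have "i' = i \<or> i' = i + 1 \<or> i = i' + 1" using nr by linarith
    then show False
    proof (elim disjE)
      assume "i' = i"
      then show False using ij(3,4) line by simp
    next
      assume i': "i' = i + 1"
      then have "p c i \<noteq> p c (i + 1)" using ij(3,4) line c_def by simp
      then show False using p1 ij(1) jj i' by metis
    next
      assume i': "i = i' + 1"
      then have "p c i' \<noteq> p c (i' + 1)" using ij(3,4) line c_def by simp
      then show False using p1 symD[OF symE ij(1)] jj i' by metis
    qed
  qed
  moreover have "((i, j), (i + 1, j + s)) \<in>
      (\<Union>k\<in>{1..3}. C True k \<times> C False k \<union> C False k \<times> C True k)"
    if "0 \<le> i" "((i, j), (i + 1, j + s)) \<notin> E" for i j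
  proof -
    define c where "c = j - s * i"
    have j: "j = c + s * i" by (simp add: c_def)
    have neq: "p c i \<noteq> p c (i + 1)"
      using p2[OF that(1), of c] that(2) by (simp add: j algebra_simps)
    have c': "j + s - s * (i + 1) = c" by (simp add: j algebra_simps)
    have "c mod 3 \<in> {0, 1, 2}" by auto
    then have "\<exists>k\<in>{1..3::nat}. c mod 3 = int k mod 3"
      by (elim insertE) (auto intro: bexI[of _ 3] bexI[of _ 1] bexI[of _ 2])
    then obtain k :: nat where k: "k \<in> {1..3}" "c mod 3 = int k mod 3" ..
    have "(i, j) \<in> C (p c i) k" "(i + 1, j + s) \<in> C (p c (i + 1)) k"
      unfolding C_def mem_Collect_eq prod.case c' c_def[symmetric] using k(2) by blast+
    then show ?thesis using k(1) neq by (cases "p c i") auto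
  qed
  ultimately show ?thesis
    unfolding biclique_cover_def
    by (intro exI[of _ "C True"] exI[of _ "C False"]) auto
qed

section \<open>Triangulations of unit squares\<close>

lemma rel_interior_triangle:
  fixes p q r :: "'a::euclidean_space"
  assumes "distinct [p, q, r]" and "0 < a" "0 < b" "0 < c" and "a + b + c = (1 :: real)"
  shows "a *\<^sub>R p + b *\<^sub>R q + c *\<^sub>R r \<in> rel_interior (convex hull {p, q, r})"
proof -
  define u where "u x = (if x = p then a else if x = q then b else c)" for x
  have "(\<forall>x\<in>{p, q, r}. 0 < u x) \<and> sum u {p, q, r} = 1 \<and>
      (\<Sum>x\<in>{p, q, r}. u x *\<^sub>R x) = a *\<^sub>R p + b *\<^sub>R q + c *\<^sub>R r"
    using assms by (auto simp: u_def)
  then show ?thesis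
    using explicit_subset_rel_interior_convex_hull_minimal[of "{p, q, r}"] by blast
qed

text \<open>For the corners \<open>p, q, r, s\<close> of a parallelogram in cyclic order, the point
  \<open>p/2 + q/4 + r/4 = p/4 + q/2 + s/4\<close> is interior to both triangles.\<close>

lemma triangles_on_common_side_overlap:
  fixes p q r s :: "'a::euclidean_space"
  assumes "distinct [p, q, r, s]" and "p + r = q + s"
  shows "rel_interior (convex hull {p, q, r}) \<inter> rel_interior (convex hull {p, q, s}) \<noteq> {}"
proof -
  have "(1/2) *\<^sub>R p + (1/4) *\<^sub>R q + (1/4) *\<^sub>R r = (1/4) *\<^sub>R p + (1/4) *\<^sub>R q + (1/4) *\<^sub>R (p + r)"
    by (simp add: algebra_simps flip: scaleR_add_left)
  also have "\<dots> = (1/4) *\<^sub>R p + (1/2) *\<^sub>R q + (1/4) *\<^sub>R s"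
    unfolding assms(2) by (simp add: algebra_simps flip: scaleR_add_left)
  finally show ?thesis
    using rel_interior_triangle[of p q r "1/2" "1/4" "1/4"]
      rel_interior_triangle[of p q s "1/4" "1/2" "1/4"] assms(1) by auto
qed

lemma convex_hull_inner_le:
  fixes T :: "'a::real_inner set"
  assumes "x \<in> convex hull T"
  shows "\<exists>v\<in>T. a \<bullet> v \<le> a \<bullet> x"
proof (rule ccontr)
  assume "\<not> ?thesis"
  then have "convex hull T \<subseteq> {v. a \<bullet> v > a \<bullet> x}"
    by (intro hull_minimal convex_halfspace_gt) auto
  then show False using assms by blast
qed

lemma card_3_in_4_points:
  assumes "distinct [p, q, r, s]" and "T \<subseteq> {p, q, r, s}" and "card T = 3" and "p \<in> T" and "q \<in> T"
  shows "T = {p, q, r} \<or> T = {p, q, s}"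
proof -
  have "\<not> {r, s} \<subseteq> T"
  proof
    assume "{r, s} \<subseteq> T"
    then have "T = {p, q, r, s}" using assms(2,4,5) by auto
    moreover have "card {p, q, r, s} = 4" using assms(1) by simp
    ultimately show False using assms(3) by simp
  qed
  moreover have "T \<noteq> {p, q}" using assms(1,3) by auto
  ultimately show ?thesis using assms(2,4,5) by blast
qed

text \<open>The point of the previous overlap lies so close to the side \<open>p q\<close> of the unit square that
  only triangles containing this side reach it. In the coordinates \<open>(\<alpha>, \<beta>)\<close> of \<open>p + \<alpha> a + \<beta> b\<close>, with
  \<open>a = q - p\<close> and \<open>b = s - p\<close>, it is \<open>(1/2, 1/4)\<close>. The functional \<open>\<alpha> + \<beta>\<close> is \<open>3/4\<close> there but at least 1 at
  every corner except \<open>p\<close>, and \<open>\<beta> - \<alpha>\<close> is \<open>-1/4\<close> there but at least 0 at every corner except \<open>q\<close>.\<close>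

lemma triangle_near_side:
  fixes p q r s :: "'a::real_inner"
  assumes par: "p + r = q + s"
    and sq: "(q - p) \<bullet> (s - p) = 0" "(q - p) \<bullet> (q - p) = 1" "(s - p) \<bullet> (s - p) = 1"
    and T: "T \<subseteq> {p, q, r, s}" "card T = 3"
    and x: "(1/2) *\<^sub>R p + (1/4) *\<^sub>R q + (1/4) *\<^sub>R r \<in> convex hull T" (is "?x \<in> _")
  shows "T = {p, q, r} \<or> T = {p, q, s}"
proof -
  define a b where "a = q - p" and "b = s - p"
  have q: "q = p + a" and s: "s = p + b" by (auto simp: a_def b_def)
  have "r = q + s - p" using par by (metis add_diff_cancel_left')
  then have r: "r = p + a + b" by (simp add: q s)
  have ab: "a \<bullet> b = 0" "b \<bullet> a = 0" "a \<bullet> a = 1" "b \<bullet> b = 1"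
    using sq by (auto simp: a_def b_def inner_commute)
  have x': "?x = p + (1/2) *\<^sub>R a + (1/4) *\<^sub>R b"
    by (simp add: q r algebra_simps flip: scaleR_add_left)
  have "p \<in> T"
    using convex_hull_inner_le[OF x, of "a + b"] T(1)
    unfolding x' by (auto simp: q r s inner_simps ab)
  moreover have "q \<in> T"
    using convex_hull_inner_le[OF x, of "b - a"] T(1)
    unfolding x' by (auto simp: q r s inner_simps ab)
  moreover have "distinct [p, q, r, s]"
  proof -
    have "(a + b) \<bullet> a \<noteq> 0" using ab by (simp add: inner_simps)
    then have "a + b \<noteq> 0" by fastforce
    then show ?thesis
      using ab by (auto simp: q r s)
  qed
  ultimately show ?thesis using card_3_in_4_points T by metis
qed

lemma grid_iff:
  "v \<in> grid d1 d2 \<longleftrightarrow> (\<exists>i j. v = (real i, real j) \<and> i \<in> {1..d1 + 1} \<and> j \<in> {1..d2 + 1})"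
  by (auto simp: grid_def)

lemma grid_triangulation_near:
  assumes "grid_triangulation d1 d2 \<T>" and "T \<in> \<T>" and "u \<in> T" and "v \<in> T"
  shows "\<bar>fst u - fst v\<bar> \<le> 1" and "\<bar>snd u - snd v\<bar> \<le> 1"
proof -
  have "infnorm (u - v) \<le> 1" using assms by (auto simp: grid_triangulation_def)
  moreover have "((1, 0) :: real \<times> real) \<in> Basis" "((0, 1) :: real \<times> real) \<in> Basis"
    by (auto simp: Basis_prod_def)
  ultimately show "\<bar>fst u - fst v\<bar> \<le> 1" "\<bar>snd u - snd v\<bar> \<le> 1"
    using Basis_le_infnorm[of "(1, 0)" "u - v"] Basis_le_infnorm[of "(0, 1)" "u - v"]
    by (auto simp: inner_prod_def)
qed

text \<open>The open unit intervals contain no integers, so \<open>T\<close> has vertices on either side of it in both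
  directions; as all vertices are at distance at most 1, they can only be corners of the square.\<close>

lemma triangle_in_unit_square:
  assumes tri: "grid_triangulation d1 d2 \<T>" and T: "T \<in> \<T>" and x: "x \<in> convex hull T"
    and x1: "real i < fst x" "fst x < real i + 1" and x2: "real j < snd x" "snd x < real j + 1"
  shows "T \<subseteq> {real i, real i + 1} \<times> {real j, real j + 1}"
proof
  fix w assume w: "w \<in> T"
  have int: "\<exists>m n. v = (real m, real n)" if "v \<in> T" for v
  proof -
    have "T \<subseteq> grid d1 d2" using tri T by (simp add: grid_triangulation_def)
    then have "v \<in> grid d1 d2" using that by blast
    then show ?thesis by (auto simp: grid_iff)
  qed
  obtain l where l: "l \<in> T" "fst l < real i + 1"
    using convex_hull_inner_le[OF x, of "(1, 0)"] x1(2) by (auto simp: inner_prod_def)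
  obtain r where r: "r \<in> T" "real i < fst r"
    using convex_hull_inner_le[OF x, of "(-1, 0)"] x1(1) by (auto simp: inner_prod_def)
  obtain b where b: "b \<in> T" "snd b < real j + 1"
    using convex_hull_inner_le[OF x, of "(0, 1)"] x2(2) by (auto simp: inner_prod_def)
  obtain t where t: "t \<in> T" "real j < snd t"
    using convex_hull_inner_le[OF x, of "(0, -1)"] x2(1) by (auto simp: inner_prod_def)
  note near = grid_triangulation_near[OF tri T]
  obtain m n where mn: "w = (real m, real n)" using int[OF w] by blast
  have "m = i \<or> m = i + 1"
  proof -
    obtain l1 l2 r1 r2 where "l = (real l1, real l2)" "r = (real r1, real r2)"
      using int[OF l(1)] int[OF r(1)] by blast
    then show ?thesis
      using l(2) r(2) near(1)[OF w l(1)] near(1)[OF w r(1)] mn by auto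
  qed
  moreover have "n = j \<or> n = j + 1"
  proof -
    obtain b1 b2 t1 t2 where "b = (real b1, real b2)" "t = (real t1, real t2)"
      using int[OF b(1)] int[OF t(1)] by blast
    then show ?thesis
      using b(2) t(2) near(2)[OF w b(1)] near(2)[OF w t(1)] mn by auto
  qed
  ultimately show "w \<in> {real i, real i + 1} \<times> {real j, real j + 1}"
    using mn by auto
qed

text \<open>For each side of the square, a triangle of \<open>\<T>\<close> covers the point close to that side, and only one
  does because the two candidates overlap. So for each side exactly one of the two triangles on it
  is in \<open>\<T>\<close>. Going around the square, this leaves only the two triangles on one diagonal. The other
  diagonal is in no triangle of \<open>\<T>\<close>: such a triangle would contain the centre of the square,
  so it would be one of the two that have just been excluded.\<close>

lemma unit_square_triangulated:
  fixes i j :: nat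
  defines "a \<equiv> (real i, real j)" and "b \<equiv> (real i + 1, real j)"
    and "c \<equiv> (real i, real j + 1)" and "e \<equiv> (real i + 1, real j + 1)"
  assumes tri: "grid_triangulation d1 d2 \<T>" and i: "i \<in> {1..d1}" and j: "j \<in> {1..d2}"
  shows "({a, b, c} \<in> \<T> \<and> {b, c, e} \<in> \<T> \<and> \<not> (\<exists>T\<in>\<T>. a \<in> T \<and> e \<in> T)) \<or>
         ({a, b, e} \<in> \<T> \<and> {a, c, e} \<in> \<T> \<and> \<not> (\<exists>T\<in>\<T>. b \<in> T \<and> c \<in> T))"
proof -
  note corners = a_def b_def c_def e_def
  have square: "{real i, real i + 1} \<times> {real j, real j + 1} = {a, b, c, e}"
    by (auto simp: corners)
  have sub: "{a, b, c, e} \<subseteq> grid d1 d2"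
  proof -
    have "(real k, real l) \<in> grid d1 d2" if "k \<in> {i, i + 1}" "l \<in> {j, j + 1}" for k l
      using that i j by (auto simp: grid_iff)
    from this[of i j] this[of "i + 1" j] this[of i "j + 1"] this[of "i + 1" "j + 1"]
    show ?thesis by (simp add: corners add.commute)
  qed
  have card3: "card T = 3" if "T \<in> \<T>" for T
    using tri that by (auto simp: grid_triangulation_def)
  have cover: "(\<Union>T\<in>\<T>. convex hull T) = convex hull (grid d1 d2)"
    using tri by (simp add: grid_triangulation_def)
  have disjoint: "rel_interior (convex hull T) \<inter> rel_interior (convex hull T') = {}"
    if "T \<in> \<T>" "T' \<in> \<T>" "T \<noteq> T'" for T T'
    using tri that by (simp add: grid_triangulation_def)
  have side: "{p, q, r} \<in> \<T> \<longleftrightarrow> {p, q, s} \<notin> \<T>"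
    if d: "distinct [p, q, r, s]" and cor: "{p, q, r, s} = {a, b, c, e}" and par: "p + r = q + s"
      and sq: "(q - p) \<bullet> (s - p) = 0" "(q - p) \<bullet> (q - p) = 1" "(s - p) \<bullet> (s - p) = 1"
      and x: "(1/2) *\<^sub>R p + (1/4) *\<^sub>R q + (1/4) *\<^sub>R r \<in> {real i<..<real i + 1} \<times> {real j<..<real j + 1}"
    for p q r s
  proof -
    let ?x = "(1/2) *\<^sub>R p + (1/4) *\<^sub>R q + (1/4) *\<^sub>R r"
    have "?x \<in> convex hull {p, q, r}"
      using rel_interior_triangle[of p q r "1/2" "1/4" "1/4"] d
        rel_interior_subset[of "convex hull {p, q, r}"] by auto
    also have "\<dots> \<subseteq> convex hull (grid d1 d2)"
      using cor sub by (intro hull_mono) auto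
    finally have "?x \<in> (\<Union>T\<in>\<T>. convex hull T)" unfolding cover .
    then obtain T where T: "T \<in> \<T>" "?x \<in> convex hull T" by blast
    have "T \<subseteq> {p, q, r, s}"
      unfolding cor square[symmetric]
      using x by (intro triangle_in_unit_square[OF tri T]) (auto simp: mem_Times_iff)
    from triangle_near_side[OF par sq this card3[OF T(1)] T(2)]
    have "{p, q, r} \<in> \<T> \<or> {p, q, s} \<in> \<T>" using T(1) by auto
    moreover have "{p, q, r} \<noteq> {p, q, s}" using d by auto
    ultimately show ?thesis
      using triangles_on_common_side_overlap[OF d par] disjoint by metis
  qed
  have no_diagonal: "\<not> (\<exists>T\<in>\<T>. p \<in> T \<and> q \<in> T)"
    if d: "distinct [p, q, r, s]" and cor: "{p, q, r, s} = {a, b, c, e}"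
      and mid: "midpoint p q = (real i + 1/2, real j + 1/2)"
      and no: "{p, q, r} \<notin> \<T>" "{p, q, s} \<notin> \<T>"
    for p q r s
  proof
    assume "\<exists>T\<in>\<T>. p \<in> T \<and> q \<in> T"
    then obtain T where T: "T \<in> \<T>" "p \<in> T" "q \<in> T" by blast
    then have "closed_segment p q \<subseteq> convex hull T"
      by (simp add: closed_segment_subset_convex_hull hull_inc)
    then have "(real i + 1/2, real j + 1/2) \<in> convex hull T"
      using mid midpoint_in_closed_segment[of p q] by auto
    then have "T \<subseteq> {p, q, r, s}"
      unfolding cor square[symmetric] by (intro triangle_in_unit_square[OF tri T(1)]) auto
    with card_3_in_4_points[OF d this card3[OF T(1)] T(2,3)] show False using T(1) no by auto
  qed
  have "{a, b, e} \<in> \<T> \<longleftrightarrow> {a, b, c} \<notin> \<T>"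
    by (rule side) (auto simp: corners inner_prod_def field_simps)
  moreover have "{b, e, c} \<in> \<T> \<longleftrightarrow> {b, e, a} \<notin> \<T>"
    by (rule side) (auto simp: corners inner_prod_def field_simps)
  moreover have "{e, c, a} \<in> \<T> \<longleftrightarrow> {e, c, b} \<notin> \<T>"
    by (rule side) (auto simp: corners inner_prod_def field_simps)
  moreover have "{b, e, c} = {b, c, e}" "{b, e, a} = {a, b, e}" "{e, c, a} = {a, c, e}"
    "{e, c, b} = {b, c, e}"
    by auto
  ultimately consider
      "{a, b, c} \<in> \<T>" "{b, c, e} \<in> \<T>" "{a, b, e} \<notin> \<T>" "{a, c, e} \<notin> \<T>"
    | "{a, b, c} \<notin> \<T>" "{b, c, e} \<notin> \<T>" "{a, b, e} \<in> \<T>" "{a, c, e} \<in> \<T>"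
    by metis
  then show ?thesis
  proof cases
    case 1
    then have "\<not> (\<exists>T\<in>\<T>. a \<in> T \<and> e \<in> T)"
      by (intro no_diagonal[of a e b c])
        (auto simp: corners midpoint_def add_divide_distrib insert_commute)
    then show ?thesis using 1 by blast
  next
    case 2
    then have "\<not> (\<exists>T\<in>\<T>. b \<in> T \<and> c \<in> T)"
      by (intro no_diagonal[of b c a e])
        (auto simp: corners midpoint_def add_divide_distrib insert_commute)
    then show ?thesis using 2 by blast
  qed
qed

section \<open>Formulations of grid triangulations\<close>

text \<open>The least value of \<open>f\<close> serves as \<open>i\<close>, unless it is \<open>d + 1\<close>. In that case \<open>f\<close> is constantly \<open>d + 1\<close>, and \<open>i = d\<close>
  works.\<close>

lemma nat_values_in_two_consecutive:
  fixes f :: "'v \<Rightarrow> nat"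
  assumes "S \<noteq> {}" and "1 \<le> d" and range: "\<And>v. v \<in> S \<Longrightarrow> f v \<in> {1..d + 1}"
    and close: "\<And>u v. u \<in> S \<Longrightarrow> v \<in> S \<Longrightarrow> f u \<le> f v + 1"
  shows "\<exists>i\<in>{1..d}. \<forall>v\<in>S. f v = i \<or> f v = i + 1"
proof -
  obtain u where "u \<in> S" using assms(1) by blast
  from ex_has_least_nat[of "\<lambda>v. v \<in> S", OF this, of f]
  obtain w where w: "w \<in> S" "\<And>v. v \<in> S \<Longrightarrow> f w \<le> f v" by blast
  have "f v = min (f w) d \<or> f v = min (f w) d + 1" if "v \<in> S" for v
    using range[OF that] range[OF w(1)] w(2)[OF that] close[OF that w(1)] by auto
  then show ?thesis using assms(2) range[OF w(1)] by (intro bexI[of _ "min (f w) d"]) auto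
qed

lemma le_two_power_ceiling_log: "1 \<le> d \<Longrightarrow> d \<le> 2 ^ nat \<lceil>log 2 (real d)\<rceil>"
proof -
  assume d: "1 \<le> d"
  have "real d = 2 powr log 2 (real d)" using d by simp
  also have "\<dots> \<le> 2 powr real (nat \<lceil>log 2 (real d)\<rceil>)"
    by (intro powr_mono) (auto simp: real_nat_ceiling_ge)
  also have "\<dots> = real (2 ^ nat \<lceil>log 2 (real d)\<rceil>)" by (simp add: powr_realpow)
  finally show ?thesis by linarith
qed

theorem theorem1:
  fixes d1 d2 :: nat and \<T> :: "(real \<times> real) set set"
  assumes "d1 \<ge> 1" and "d2 \<ge> 1"
    and "grid_triangulation d1 d2 \<T>"
  shows "\<exists>A B. independent_branching_formulation (grid d1 d2)
           (\<Union>T\<in>\<T>. simplex_face (grid d1 d2) T)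
           (nat (\<lceil>log 2 (real d1)\<rceil> + \<lceil>log 2 (real d2)\<rceil> + 6)) A B"
proof -
  define V where "V = grid d1 d2"
  define E where "E = {(u, v). \<exists>T\<in>\<T>. u \<in> T \<and> v \<in> T}"
  define z where "z v = (\<lfloor>fst v\<rfloor>, \<lfloor>snd v\<rfloor>)" for v :: "real \<times> real"
  define r1 r2 where "r1 = nat \<lceil>log 2 (real d1)\<rceil>" and "r2 = nat \<lceil>log 2 (real d2)\<rceil>"
  define X where "X = {(u, v). u \<in> V \<and> v \<in> V \<and> \<bar>fst (z u) - fst (z v)\<bar> \<ge> 2}"
  define Y where "Y = {(u, v). u \<in> V \<and> v \<in> V \<and> \<bar>snd (z u) - snd (z v)\<bar> \<ge> 2}"
  define D where "D s = {(u, v). u \<in> V \<and> v \<in> V \<and> fst (z v) = fst (z u) + 1 \<and>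
      snd (z v) = snd (z u) + s \<and> (u, v) \<notin> E}" for s :: int

  have inV: "u \<in> V" "v \<in> V" if "(u, v) \<in> E" for u v
    using assms(3) that by (auto simp: grid_triangulation_def E_def V_def)
  have zV: "fst (z v) \<in> {1..int d1 + 1} \<and> snd (z v) \<in> {1..int d2 + 1}" if "v \<in> V" for v
    using that by (auto simp: V_def z_def grid_iff)
  have z_inverse: "v = (of_int (fst (z v)), of_int (snd (z v)))" if "v \<in> V" for v
    using that by (auto simp: V_def z_def grid_iff)
  have injz: "inj_on z V"
    by (rule inj_onI) (metis z_inverse)
  have near: "\<bar>fst (z u) - fst (z v)\<bar> \<le> 1 \<and> \<bar>snd (z u) - snd (z v)\<bar> \<le> 1"
    if uv: "(u, v) \<in> E" for u v
  proof -
    obtain T where "T \<in> \<T>" "u \<in> T" "v \<in> T" using uv by (auto simp: E_def)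
    then have "\<bar>fst u - fst v\<bar> \<le> 1" "\<bar>snd u - snd v\<bar> \<le> 1"
      by (rule grid_triangulation_near[OF assms(3)])+
    moreover obtain m n m' n' where "u = (of_int m, of_int n)" "v = (of_int m', of_int n')"
      using z_inverse inV[OF uv] by metis
    ultimately show ?thesis by (auto simp: z_def)
  qed

  \<comment> \<open>The coordinates \<open>1, \<dots>, d1 + 1\<close> are shifted to the path \<open>0, \<dots>, d1\<close>.\<close>
  have "biclique_cover E X r1"
  proof (rule biclique_cover_vimage[OF biclique_cover_path, where f = "\<lambda>v. fst (z v) - 1"])
    fix u v assume "(u, v) \<in> X"
    then have uv: "u \<in> V" "v \<in> V" "\<bar>fst (z u) - fst (z v)\<bar> \<ge> 2" by (auto simp: X_def)
    have "int d1 \<le> int (2 ^ r1)"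
      unfolding r1_def of_nat_le_iff by (rule le_two_power_ceiling_log[OF assms(1)])
    then have "int d1 \<le> 2 ^ r1" by (simp only: of_nat_power of_nat_numeral)
    moreover have "fst (z u) \<in> {1..int d1 + 1}" "fst (z v) \<in> {1..int d1 + 1}"
      using zV uv by blast+
    ultimately have "fst (z u) - 1 \<in> {0..2 ^ r1}" "fst (z v) - 1 \<in> {0..2 ^ r1}"
      unfolding atLeastAtMost_iff by linarith+
    then show "(fst (z u) - 1, fst (z v) - 1) \<in>
        {(u, v). u \<in> {0..2 ^ r1} \<and> v \<in> {0..2 ^ r1} \<and> \<bar>u - v\<bar> \<ge> 2}"
      using uv(3) by simp
  qed (use near in auto)
  moreover have "biclique_cover E Y r2"
  proof (rule biclique_cover_vimage[OF biclique_cover_path, where f = "\<lambda>v. snd (z v) - 1"])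
    fix u v assume "(u, v) \<in> Y"
    then have uv: "u \<in> V" "v \<in> V" "\<bar>snd (z u) - snd (z v)\<bar> \<ge> 2" by (auto simp: Y_def)
    have "int d2 \<le> int (2 ^ r2)"
      unfolding r2_def of_nat_le_iff by (rule le_two_power_ceiling_log[OF assms(2)])
    then have "int d2 \<le> 2 ^ r2" by (simp only: of_nat_power of_nat_numeral)
    moreover have "snd (z u) \<in> {1..int d2 + 1}" "snd (z v) \<in> {1..int d2 + 1}"
      using zV uv by blast+
    ultimately have "snd (z u) - 1 \<in> {0..2 ^ r2}" "snd (z v) - 1 \<in> {0..2 ^ r2}"
      unfolding atLeastAtMost_iff by linarith+
    then show "(snd (z u) - 1, snd (z v) - 1) \<in>
        {(u, v). u \<in> {0..2 ^ r2} \<and> v \<in> {0..2 ^ r2} \<and> \<bar>u - v\<bar> \<ge> 2}"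
      using uv(3) by simp
  qed (use near in auto)
  moreover have "biclique_cover E (D s) 3" if s: "\<bar>s\<bar> = 1" for s
  proof -
    let ?E = "map_prod z z ` E"
    have "(v, u) \<in> E" if "(u, v) \<in> E" for u v
      using that by (auto simp: E_def)
    then have "sym ?E" by (intro symI) force
    moreover have "\<bar>fst p - fst q\<bar> \<le> 1 \<and> \<bar>snd p - snd q\<bar> \<le> 1" if pq: "(p, q) \<in> ?E" for p q
    proof -
      obtain w where w: "(p, q) = map_prod z z w" "w \<in> E"
        using pq by (rule imageE)
      obtain u v where "w = (u, v)" by (rule prod.exhaust)
      then have "(u, v) \<in> E" "p = z u" "q = z v" using w by simp_all
      then show ?thesis using near[of u v] by simp
    qed
    ultimately have cov: "biclique_cover ?E
        {((i, j), (i', j')). 0 \<le> i \<and> i' = i + 1 \<and> j' = j + s \<and> ((i, j), (i', j')) \<notin> ?E} 3"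
      by (rule biclique_cover_diagonals[OF s])
    show ?thesis
    proof (rule biclique_cover_vimage[OF cov, where f = z])
      fix u v assume uv: "(u, v) \<in> D s"
      then have "u \<in> V" "v \<in> V" by (auto simp: D_def)
      then have "map_prod z z (u, v) \<in> ?E \<longleftrightarrow> (u, v) \<in> E"
        using inV by (intro inj_on_image_mem_iff[OF map_prod_inj_on[OF injz injz]]) auto
      then have "(z u, z v) \<notin> ?E" using uv by (simp add: D_def)
      then show "(z u, z v) \<in>
          {((i, j), (i', j')). 0 \<le> i \<and> i' = i + 1 \<and> j' = j + s \<and> ((i, j), (i', j')) \<notin> ?E}"
        using uv zV[OF \<open>u \<in> V\<close>] by (cases "z u"; cases "z v") (simp add: D_def)
    qed force
  qed
  ultimately have cover: "biclique_cover E (X \<union> (Y \<union> (D 1 \<union> D (-1)))) (r1 + (r2 + (3 + 3)))"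
    by (intro biclique_cover_Un) simp_all
  have depth: "nat (\<lceil>log 2 (real d1)\<rceil> + \<lceil>log 2 (real d2)\<rceil> + 6) = r1 + (r2 + (3 + 3))"
  proof -
    have "0 \<le> log 2 (real d1)" "0 \<le> log 2 (real d2)"
      using assms(1,2) by simp_all
    then have "0 \<le> \<lceil>log 2 (real d1)\<rceil>" "0 \<le> \<lceil>log 2 (real d2)\<rceil>"
      by linarith+
    then show ?thesis by (simp add: r1_def r2_def nat_add_distrib)
  qed
  have clique: "\<exists>T\<in>\<T>. S \<subseteq> T"
    if S: "S \<subseteq> V" "S \<noteq> {}" and free: "S \<times> S \<inter> (X \<union> (Y \<union> (D 1 \<union> D (-1)))) = {}" for S
  proof -
    have close: "\<bar>fst (z u) - fst (z v)\<bar> \<le> 1 \<and> \<bar>snd (z u) - snd (z v)\<bar> \<le> 1"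
      if "u \<in> S" "v \<in> S" for u v
    proof -
      have "(u, v) \<notin> X" "(u, v) \<notin> Y" using free that by auto
      then show ?thesis using that S(1) by (auto simp: X_def Y_def)
    qed
    have "\<exists>i\<in>{1..d1}. \<forall>v\<in>S. nat (fst (z v)) = i \<or> nat (fst (z v)) = i + 1"
    proof (rule nat_values_in_two_consecutive[OF S(2) assms(1)])
      show "nat (fst (z v)) \<in> {1..d1 + 1}" if "v \<in> S" for v
      proof -
        have "fst (z v) \<in> {1..int d1 + 1}" using zV that S(1) by blast
        then show ?thesis by auto
      qed
      show "nat (fst (z u)) \<le> nat (fst (z v)) + 1" if "u \<in> S" "v \<in> S" for u v
        using close[OF that] by auto
    qed
    then obtain i where i: "i \<in> {1..d1}" "\<forall>v\<in>S. nat (fst (z v)) = i \<or> nat (fst (z v)) = i + 1" ..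
    have "\<exists>j\<in>{1..d2}. \<forall>v\<in>S. nat (snd (z v)) = j \<or> nat (snd (z v)) = j + 1"
    proof (rule nat_values_in_two_consecutive[OF S(2) assms(2)])
      show "nat (snd (z v)) \<in> {1..d2 + 1}" if "v \<in> S" for v
      proof -
        have "snd (z v) \<in> {1..int d2 + 1}" using zV that S(1) by blast
        then show ?thesis by auto
      qed
      show "nat (snd (z u)) \<le> nat (snd (z v)) + 1" if "u \<in> S" "v \<in> S" for u v
        using close[OF that] by auto
    qed
    then obtain j where j: "j \<in> {1..d2}" "\<forall>v\<in>S. nat (snd (z v)) = j \<or> nat (snd (z v)) = j + 1" ..
    define a b c e where "a = (real i, real j)" and "b = (real i + 1, real j)"
      and "c = (real i, real j + 1)" and "e = (real i + 1, real j + 1)"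
    note corners = a_def b_def c_def e_def
    have square: "S \<subseteq> {a, b, c, e}"
    proof
      fix v assume v: "v \<in> S"
      then have "v \<in> grid d1 d2" using S(1) by (auto simp: V_def)
      then obtain m n where mn: "v = (real m, real n)" by (auto simp: grid_iff)
      then have "m = i \<or> m = i + 1" "n = j \<or> n = j + 1"
        using i(2) j(2) v by (auto simp: z_def)
      then show "v \<in> {a, b, c, e}" by (auto simp: mn corners)
    qed
    have zs: "z a = (int i, int j)" "z b = (int i + 1, int j)" "z c = (int i, int j + 1)"
      "z e = (int i + 1, int j + 1)"
      by (auto simp: corners z_def)
    have "\<not> (a \<in> S \<and> e \<in> S)" if "\<not> (\<exists>T\<in>\<T>. a \<in> T \<and> e \<in> T)"
    proof
      assume ae: "a \<in> S \<and> e \<in> S"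
      then have "a \<in> V" "e \<in> V" using S(1) by blast+
      then have "(a, e) \<in> D 1" using that by (simp add: D_def E_def zs)
      then show False using ae free by auto
    qed
    moreover have "\<not> (b \<in> S \<and> c \<in> S)" if "\<not> (\<exists>T\<in>\<T>. b \<in> T \<and> c \<in> T)"
    proof
      assume bc: "b \<in> S \<and> c \<in> S"
      then have "b \<in> V" "c \<in> V" using S(1) by blast+
      \<comment> \<open>The antidiagonal is traversed from its upper left end \<open>c\<close>, by the step \<open>(1, -1)\<close>.\<close>
      then have "(c, b) \<in> D (-1)" using that by (auto simp: D_def E_def zs)
      then show False using bc free by auto
    qed
    moreover note unit_square_triangulated[OF assms(3) i(1) j(1), folded corners]
    ultimately consider
        "a \<notin> S" "{b, c, e} \<in> \<T>" | "e \<notin> S" "{a, b, c} \<in> \<T>"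
      | "b \<notin> S" "{a, c, e} \<in> \<T>" | "c \<notin> S" "{a, b, e} \<in> \<T>"
      by blast
    then show ?thesis
    proof cases
      case 1
      then have "S \<subseteq> {b, c, e}" using square by blast
      then show ?thesis using 1(2) by blast
    next
      case 2
      then have "S \<subseteq> {a, b, c}" using square by blast
      then show ?thesis using 2(2) by blast
    next
      case 3
      then have "S \<subseteq> {a, c, e}" using square by blast
      then show ?thesis using 3(2) by blast
    next
      case 4
      then have "S \<subseteq> {a, b, e}" using square by blast
      then show ?thesis using 4(2) by blast
    qed
  qed
  have "finite V" by (simp add: V_def grid_def)
  from branching_formulation_of_biclique_cover[OF this cover[unfolded E_def] clique]
  show ?thesis unfolding depth V_def .
qed

end
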